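(* Let $k\ge1$ and $n\ge0$ be integers, let $m_1<\dots<m_k$ be distinct non-negative integers and $m=\sum_{i=1}^k m_i$. Then the following identity of polynomials in $x_1,\dots,x_k$ (with rational coefficients) holds: $$b_{m_1,\dots,m_k}(x_1,\dots,x_k)\left(\sum_{i=1}^k x_i-m\right)^{\underline{n}}=\sum_{n_1+\dots+n_k=n+m}\frac{n!}{\prod_{i=1}^k n_i!}\,b_{m_1,\dots,m_k}(n_1,\dots,n_k)\cdot\prod_{i=1}^k x_i^{\underline{n_i}},$$ where the sum is over $k$-tuples of non-negative integers $(n_1,\dots,n_k)$ with sum $n+m$.
   Context: Falling factorial: $x^{\underline{n}}=x(x-1)\cdots(x-n+1)$, $x^{\underline{0}}=1$. For non-negative integers $m_1,\dots,m_k$, $b_{m_1,\dots,m_k}(x_1,\dots,x_k)=\det\left(x_i^{\underline{m_j}}\right)_{i,j=1}^k$. *)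

theory Defs
  imports
    "Jordan_Normal_Form.Determinant"
    "HOL-Library.Poly_Mapping"
    "HOL-Library.FuncSet"
begin

definition ffact :: "'a::comm_ring_1 \<Rightarrow> nat \<Rightarrow> 'a" where
  "ffact x n = (\<Prod>i<n. x - of_nat i)"

text \<open>
  Indices run over \<open>0, \<dots>, k - 1\<close> throughout, so \<open>x i\<close> stands for $x_{i+1}$ and \<open>ms j\<close>
  for $m_{j+1}$; values of \<open>x\<close> and \<open>ms\<close> at other indices are irrelevant.
\<close>

definition bdet :: "nat \<Rightarrow> (nat \<Rightarrow> nat) \<Rightarrow> (nat \<Rightarrow> 'a::comm_ring_1) \<Rightarrow> 'a" where
  "bdet k ms x = det (mat k k (\<lambda>(i, j). ffact (x i) (ms j)))"

text \<open>
  Polynomials over the rationals in indeterminates indexed by \<open>nat\<close>: a finitely supported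
  map from monomials (finitely supported exponent vectors) to coefficients, with the
  convolution product of \<open>Poly_Mapping\<close>. The ring in $k$ indeterminates is the subring on
  the indices below \<open>k\<close>.
\<close>

type_synonym rat_mpoly = "(nat \<Rightarrow>\<^sub>0 nat) \<Rightarrow>\<^sub>0 rat"

definition Const :: "rat \<Rightarrow> rat_mpoly" where
  "Const c = Poly_Mapping.single 0 c"

definition Var :: "nat \<Rightarrow> rat_mpoly" where
  "Var i = Poly_Mapping.single (Poly_Mapping.single i 1) 1"

text \<open>Extensionality outside \<open>{..<k}\<close> makes each tuple occur exactly once.\<close>

definition tuples_with_sum :: "nat \<Rightarrow> nat \<Rightarrow> (nat \<Rightarrow> nat) set" where
  "tuples_with_sum k s = {\<nu> \<in> {..<k} \<rightarrow>\<^sub>E UNIV. (\<Sum>i<k. \<nu> i) = s}"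

end

theory Submission
  imports Defs
begin

text \<open>
  Expanding the determinant on both sides by the Leibniz formula reduces the identity to one
  about a single permutation \<open>p\<close>, that is, about a single product of falling factorials
  $\prod_i x_i^{\underline{\mu_i}}$ with \<open>\<mu>\<^sub>i = ms (p i)\<close>; every such \<open>\<mu>\<close> has the same sum \<open>m\<close>, so
  the factor $(\sum_i x_i - m)^{\underline{n}}$ is always $(\sum_i (x_i - \mu_i))^{\underline{n}}$.

  The multivariate Chu--Vandermonde identity (\<open>ffact_sum\<close>) expands this factor into products
  $\prod_i (x_i - \mu_i)^{\underline{a_i}}$ with $\sum_i a_i = n$ and multinomial coefficients.
  Since $x^{\underline{\mu}} (x - \mu)^{\underline{a}} = x^{\underline{\mu + a}}$, multiplying
  by $\prod_i x_i^{\underline{\mu_i}}$ turns the products into $\prod_i x_i^{\underline{\nu_i}}$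
  for \<open>\<nu> = \<mu> + a\<close>, and the coefficient is rewritten by
  $1 / a_i! = \nu_i^{\underline{\mu_i}} / \nu_i!$. The right-hand side of the last equation
  vanishes when \<open>\<nu>\<^sub>i < \<mu>\<^sub>i\<close>, so the sum may be taken over all tuples \<open>\<nu>\<close> of sum \<open>n + m\<close>
  (\<open>prod_ffact_mult_ffact_sum\<close>). The coefficients $\prod_i \nu_i^{\underline{\mu_i}}$ are then
  the Leibniz terms of the determinant evaluated at \<open>\<nu>\<close>.
\<close>

section \<open>Falling factorials\<close>

lemma ffact_0 [simp]: "ffact x 0 = 1"
  by (simp add: ffact_def)

lemma ffact_conv_pochhammer: "ffact x n = (-1) ^ n * pochhammer (- x) n"
proof -
  have "ffact x n = (\<Prod>i<n. (-1) * (- x + of_nat i))"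
    by (simp add: ffact_def)
  also have "\<dots> = (-1) ^ n * pochhammer (- x) n"
    unfolding prod.distrib by (simp add: pochhammer_prod atLeast0LessThan)
  finally show ?thesis .
qed

lemma ffact_add_right: "ffact x (m + n) = ffact x m * ffact (x - of_nat m) n"
  by (induction n) (simp_all add: ffact_def algebra_simps)

text \<open>The Chu--Vandermonde identity, transported from rising factorials by negating the arguments.\<close>

lemma ffact_add_left:
  "ffact (x + y) n = (\<Sum>j\<le>n. of_nat (n choose j) * ffact x j * ffact y (n - j))"
proof -
  have "ffact (x + y) n = (-1) ^ n * pochhammer (- x + - y) n"
    by (simp add: ffact_conv_pochhammer)
  also have "\<dots> = (\<Sum>j\<le>n. (-1) ^ n * (of_nat (n choose j) * pochhammer (- x) j * pochhammer (- y) (n - j)))"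
    unfolding pochhammer_binomial_sum sum_distrib_left ..
  also have "\<dots> = (\<Sum>j\<le>n. of_nat (n choose j) * ffact x j * ffact y (n - j))"
  proof (rule sum.cong)
    fix j assume "j \<in> {..n}"
    then have "(-1 :: 'a) ^ n = (-1) ^ j * (-1) ^ (n - j)"
      by (simp flip: power_add)
    then show "(-1) ^ n * (of_nat (n choose j) * pochhammer (- x) j * pochhammer (- y) (n - j)) =
        of_nat (n choose j) * ffact x j * ffact y (n - j)"
      by (simp add: ffact_conv_pochhammer mult_ac)
  qed simp
  finally show ?thesis .
qed

lemma ffact_of_nat_eq_0: "a < b \<Longrightarrow> ffact (of_nat a) b = 0"
  by (auto simp: ffact_def intro!: prod_zero)

lemma ffact_of_nat_mult_fact: "ffact (of_nat (a + b)) a * fact b = (fact (a + b) :: 'a :: {comm_ring_1, semiring_char_0})"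
proof (induction a)
  case (Suc a)
  have "ffact (of_nat (Suc a + b)) (Suc a) = (of_nat (Suc (a + b)) :: 'a) * ffact (of_nat (a + b)) a"
    using ffact_add_right[of "of_nat (Suc a + b) :: 'a" 1 a] by (simp add: ffact_def)
  with Suc show ?case
    by (simp add: mult.assoc)
qed simp

section \<open>The constant polynomials\<close>

lemma Const_0 [simp]: "Const 0 = 0"
  and Const_1 [simp]: "Const 1 = 1"
  and Const_add: "Const (a + b) = Const a + Const b"
  and Const_uminus: "Const (- a) = - Const a"
  and Const_mult: "Const (a * b) = Const a * Const b"
  by (simp_all add: Const_def single_add single_uminus mult_single)

lemma Const_sum: "Const (sum f A) = (\<Sum>i\<in>A. Const (f i))"
  by (induction A rule: infinite_finite_induct) (simp_all add: Const_add)

lemma Const_of_nat: "Const (of_nat n) = of_nat n"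
  by (induction n) (simp_all add: Const_add)

lemma Const_sign: "Const (of_int (sign p)) = of_int (sign p)"
  by (simp add: sign_def Const_uminus)

section \<open>Tuples with prescribed sum\<close>

lemma finite_tuples_with_sum: "finite (tuples_with_sum k s)"
proof (rule finite_subset)
  show "tuples_with_sum k s \<subseteq> ({..<k} \<rightarrow>\<^sub>E {..s})"
    by (auto simp: tuples_with_sum_def intro!: PiE_I member_le_sum elim: PiE_arb)
  show "finite ({..<k} \<rightarrow>\<^sub>E {..s})"
    by (intro finite_PiE) auto
qed

lemma sum_tuples_with_sum_Suc:
  "(\<Sum>\<nu>\<in>tuples_with_sum (Suc k) s. f \<nu>) =
   (\<Sum>j\<le>s. \<Sum>\<nu>\<in>tuples_with_sum k (s - j). f (\<nu>(k := j)))"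
proof -
  have "(\<Sum>j\<le>s. \<Sum>\<nu>\<in>tuples_with_sum k (s - j). f (\<nu>(k := j))) =
    (\<Sum>(j, \<nu>)\<in>(SIGMA j:{..s}. tuples_with_sum k (s - j)). f (\<nu>(k := j)))"
    by (simp add: sum.Sigma finite_tuples_with_sum)
  also have "\<dots> = (\<Sum>\<nu>\<in>tuples_with_sum (Suc k) s. f \<nu>)"
  proof (rule sum.reindex_bij_witness[of _ "\<lambda>\<nu>. (\<nu> k, restrict \<nu> {..<k})" "\<lambda>(j, \<nu>). \<nu>(k := j)"])
    fix a assume "a \<in> (SIGMA j:{..s}. tuples_with_sum k (s - j))"
    then obtain j \<nu> where a: "a = (j, \<nu>)" "j \<le> s" "\<nu> \<in> {..<k} \<rightarrow>\<^sub>E UNIV" "(\<Sum>i<k. \<nu> i) = s - j"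
      by (auto simp: tuples_with_sum_def)
    have "restrict (\<nu>(k := j)) {..<k} = \<nu>"
      using a(3) by (auto simp: fun_eq_iff PiE_iff extensional_def)
    then show "(\<lambda>\<nu>. (\<nu> k, restrict \<nu> {..<k})) (case a of (j, \<nu>) \<Rightarrow> \<nu>(k := j)) = a"
      using a by simp
    show "(case a of (j, \<nu>) \<Rightarrow> \<nu>(k := j)) \<in> tuples_with_sum (Suc k) s"
      using a by (auto simp: tuples_with_sum_def PiE_iff extensional_def)
    show "f (case a of (j, \<nu>) \<Rightarrow> \<nu>(k := j)) = (case a of (j, \<nu>) \<Rightarrow> f (\<nu>(k := j)))"
      by (simp add: a)
  next
    fix \<nu> assume \<nu>: "\<nu> \<in> tuples_with_sum (Suc k) s"
    then have ext: "\<nu> \<in> extensional {..<Suc k}" and sum: "(\<Sum>i<k. \<nu> i) + \<nu> k = s"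
      by (auto simp: tuples_with_sum_def PiE_iff)
    show "(case (\<nu> k, restrict \<nu> {..<k}) of (j, \<nu>) \<Rightarrow> \<nu>(k := j)) = \<nu>"
      using ext by (auto simp: fun_eq_iff extensional_def)
    show "(\<nu> k, restrict \<nu> {..<k}) \<in> (SIGMA j:{..s}. tuples_with_sum k (s - j))"
      using sum by (auto simp: tuples_with_sum_def)
  qed
  finally show ?thesis ..
qed

text \<open>
  The translation \<open>a \<mapsto> \<mu> + a\<close> maps the tuples of sum \<open>n\<close> onto the tuples of sum
  $n + \sum_i \mu_i$ that dominate \<open>\<mu>\<close>.
\<close>

lemma sum_tuples_with_sum_shift:
  "(\<Sum>a\<in>tuples_with_sum k n. f (\<lambda>i\<in>{..<k}. \<mu> i + a i)) =
   (\<Sum>\<nu>\<in>{\<nu> \<in> tuples_with_sum k (n + (\<Sum>i<k. \<mu> i)). \<forall>i<k. \<mu> i \<le> \<nu> i}. f \<nu>)"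
proof (rule sum.reindex_bij_witness[of _ "\<lambda>\<nu>. \<lambda>i\<in>{..<k}. \<nu> i - \<mu> i" "\<lambda>a. \<lambda>i\<in>{..<k}. \<mu> i + a i"])
  fix a assume a: "a \<in> tuples_with_sum k n"
  then show "(\<lambda>i\<in>{..<k}. (\<lambda>i\<in>{..<k}. \<mu> i + a i) i - \<mu> i) = a"
    by (auto simp: fun_eq_iff tuples_with_sum_def PiE_iff extensional_def)
  show "(\<lambda>i\<in>{..<k}. \<mu> i + a i) \<in> {\<nu> \<in> tuples_with_sum k (n + (\<Sum>i<k. \<mu> i)). \<forall>i<k. \<mu> i \<le> \<nu> i}"
    using a by (simp add: tuples_with_sum_def sum.distrib)
next
  fix \<nu> assume \<nu>: "\<nu> \<in> {\<nu> \<in> tuples_with_sum k (n + (\<Sum>i<k. \<mu> i)). \<forall>i<k. \<mu> i \<le> \<nu> i}"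
  then show "(\<lambda>i\<in>{..<k}. \<mu> i + (\<lambda>i\<in>{..<k}. \<nu> i - \<mu> i) i) = \<nu>"
    by (auto simp: fun_eq_iff tuples_with_sum_def PiE_iff extensional_def)
  show "(\<lambda>i\<in>{..<k}. \<nu> i - \<mu> i) \<in> tuples_with_sum k n"
    using \<nu> sum_subtractf_nat[of "{..<k}" \<mu> \<nu>] by (simp add: tuples_with_sum_def)
qed simp

section \<open>The identity for a single product of falling factorials\<close>

text \<open>
  The multivariate Chu--Vandermonde identity, by splitting off the last variable with the
  two-variable one.
\<close>

lemma ffact_sum:
  "ffact (\<Sum>i<k. x i) n =
   (\<Sum>a\<in>tuples_with_sum k n. Const (fact n / (\<Prod>i<k. fact (a i))) * (\<Prod>i<k. ffact (x i) (a i)))"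
proof (induction k arbitrary: n)
  case 0
  have "tuples_with_sum 0 n = (if n = 0 then {\<lambda>_. undefined} else {})"
    by (auto simp: tuples_with_sum_def)
  then show ?case
    by (cases n) (simp_all add: ffact_def prod.lessThan_Suc_shift del: prod.lessThan_Suc)
next
  case (Suc k)
  have "ffact (\<Sum>i<Suc k. x i) n = ffact (x k + (\<Sum>i<k. x i)) n"
    by (simp add: add.commute)
  also have "\<dots> = (\<Sum>j\<le>n. \<Sum>a\<in>tuples_with_sum k (n - j).
      of_nat (n choose j) * ffact (x k) j *
        (Const (fact (n - j) / (\<Prod>i<k. fact (a i))) * (\<Prod>i<k. ffact (x i) (a i))))"
    unfolding ffact_add_left Suc.IH sum_distrib_left ..
  also have "\<dots> = (\<Sum>j\<le>n. \<Sum>a\<in>tuples_with_sum k (n - j).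
      Const (fact n / (\<Prod>i<Suc k. fact ((a(k := j)) i))) * (\<Prod>i<Suc k. ffact (x i) ((a(k := j)) i)))"
  proof (intro sum.cong refl)
    fix j a assume j: "j \<in> {..n}"
    have "rat_of_nat (n choose j) * (fact (n - j) / (\<Prod>i<k. fact (a i))) =
        fact n / ((\<Prod>i<k. fact (a i)) * fact j)"
      using j by (simp add: binomial_fact)
    then have "of_nat (n choose j) * Const (fact (n - j) / (\<Prod>i<k. fact (a i))) =
        Const (fact n / ((\<Prod>i<k. fact (a i)) * fact j))"
      by (simp flip: Const_of_nat Const_mult)
    then show "of_nat (n choose j) * ffact (x k) j *
        (Const (fact (n - j) / (\<Prod>i<k. fact (a i))) * (\<Prod>i<k. ffact (x i) (a i))) =
      Const (fact n / (\<Prod>i<Suc k. fact ((a(k := j)) i))) * (\<Prod>i<Suc k. ffact (x i) ((a(k := j)) i))"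
      by (simp add: mult_ac)
  qed
  also have "\<dots> = (\<Sum>a\<in>tuples_with_sum (Suc k) n.
      Const (fact n / (\<Prod>i<Suc k. fact (a i))) * (\<Prod>i<Suc k. ffact (x i) (a i)))"
    by (rule sum_tuples_with_sum_Suc[symmetric])
  finally show ?case .
qed

text \<open>
  What each term of the Leibniz expansion contributes. Allowing every \<open>\<nu>\<close>, also one that does
  not dominate \<open>\<mu>\<close>, makes the index set of the sum depend on \<open>\<mu>\<close> only through its sum,
  so that the contributions of different permutations can be added up.
\<close>

lemma prod_ffact_mult_ffact_sum:
  "(\<Prod>i<k. ffact (x i) (\<mu> i)) * ffact ((\<Sum>i<k. x i) - of_nat (\<Sum>i<k. \<mu> i)) n =
   (\<Sum>\<nu>\<in>tuples_with_sum k (n + (\<Sum>i<k. \<mu> i)).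
      Const (fact n / (\<Prod>i<k. fact (\<nu> i)) * (\<Prod>i<k. ffact (of_nat (\<nu> i)) (\<mu> i))) *
      (\<Prod>i<k. ffact (x i) (\<nu> i)))"
    (is "?lhs = sum ?f ?T")
proof -
  let ?D = "{\<nu> \<in> ?T. \<forall>i<k. \<mu> i \<le> \<nu> i}"
  have "(\<Sum>i<k. x i) - of_nat (\<Sum>i<k. \<mu> i) = (\<Sum>i<k. x i - of_nat (\<mu> i))"
    by (simp add: sum_subtractf)
  then have "?lhs = (\<Sum>a\<in>tuples_with_sum k n. (\<Prod>i<k. ffact (x i) (\<mu> i)) *
      (Const (fact n / (\<Prod>i<k. fact (a i))) * (\<Prod>i<k. ffact (x i - of_nat (\<mu> i)) (a i))))"
    by (simp add: ffact_sum sum_distrib_left)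
  also have "\<dots> = (\<Sum>a\<in>tuples_with_sum k n. ?f (\<lambda>i\<in>{..<k}. \<mu> i + a i))"
  proof (intro sum.cong refl)
    fix a :: "nat \<Rightarrow> nat"
    have x: "(\<Prod>i<k. ffact (x i) (\<mu> i + a i)) =
        (\<Prod>i<k. ffact (x i) (\<mu> i)) * (\<Prod>i<k. ffact (x i - of_nat (\<mu> i)) (a i))"
      by (simp add: ffact_add_right prod.distrib)
    have "(\<Prod>i<k. fact (\<mu> i + a i)) =
        (\<Prod>i<k. ffact (rat_of_nat (\<mu> i + a i)) (\<mu> i)) * (\<Prod>i<k. fact (a i))"
      unfolding prod.distrib[symmetric] ffact_of_nat_mult_fact ..
    moreover have "(\<Prod>i<k. fact (\<mu> i + a i)) \<noteq> (0 :: rat)"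
      by simp
    ultimately have c: "fact n / (\<Prod>i<k. fact (a i)) = fact n / (\<Prod>i<k. fact (\<mu> i + a i)) *
        (\<Prod>i<k. ffact (rat_of_nat (\<mu> i + a i)) (\<mu> i))"
      by (simp add: field_simps)
    show "(\<Prod>i<k. ffact (x i) (\<mu> i)) *
        (Const (fact n / (\<Prod>i<k. fact (a i))) * (\<Prod>i<k. ffact (x i - of_nat (\<mu> i)) (a i))) =
      ?f (\<lambda>i\<in>{..<k}. \<mu> i + a i)"
      unfolding c by (simp add: x mult_ac)
  qed
  also have "\<dots> = sum ?f ?D"
    by (rule sum_tuples_with_sum_shift)
  also have "\<dots> = sum ?f ?T"
  proof (rule sum.mono_neutral_left)
    show "\<forall>\<nu>\<in>?T - ?D. ?f \<nu> = 0"
    proof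
      fix \<nu> assume "\<nu> \<in> ?T - ?D"
      then obtain i where "i < k" "\<nu> i < \<mu> i"
        by (auto simp: not_le)
      then have "(\<Prod>i<k. ffact (rat_of_nat (\<nu> i)) (\<mu> i)) = 0"
        by (auto intro!: prod_zero ffact_of_nat_eq_0)
      then show "?f \<nu> = 0"
        by (simp only: mult_zero_right mult_zero_left Const_0)
    qed
  qed (auto simp: finite_tuples_with_sum)
  finally show ?thesis .
qed

section \<open>The determinantal identity\<close>

lemma bdet_Leibniz:
  "bdet k ms x = (\<Sum>p | p permutes {..<k}. of_int (sign p) * (\<Prod>i<k. ffact (x i) (ms (p i))))"
  unfolding bdet_def det_def'[OF mat_carrier] atLeast0LessThan
proof (intro sum.cong refl arg_cong2[where f = "(*)"] prod.cong)
  fix p i assume "p \<in> {p. p permutes {..<k}}" "i \<in> {..<k}"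
  then have "i < k" "p i < k"
    using permutes_in_image[of p "{..<k}" i] by auto
  then show "mat k k (\<lambda>(i, j). ffact (x i) (ms j)) $$ (i, p i) = ffact (x i) (ms (p i))"
    by simp
qed

theorem theorem5:
  fixes k n m :: nat and ms :: "nat \<Rightarrow> nat"
  assumes "k \<ge> 1"
    and "strict_mono_on {..<k} ms"
    and "m = (\<Sum>i<k. ms i)"
  shows "bdet k ms Var * ffact ((\<Sum>i<k. Var i) - of_nat m) n =
    (\<Sum>\<nu> \<in> tuples_with_sum k (n + m).
      Const (fact n / (\<Prod>i<k. fact (\<nu> i)) * bdet k ms (\<lambda>i. of_nat (\<nu> i))) *
      (\<Prod>i<k. ffact (Var i) (\<nu> i)))"
proof -
  let ?P = "{p. p permutes {..<k}}" and ?T = "tuples_with_sum k (n + m)"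
  let ?c = "\<lambda>p \<nu>. \<Prod>i<k. ffact (rat_of_nat (\<nu> i)) (ms (p i))"
  have "bdet k ms Var * ffact ((\<Sum>i<k. Var i) - of_nat m) n =
    (\<Sum>p\<in>?P. of_int (sign p) *
      ((\<Prod>i<k. ffact (Var i) (ms (p i))) * ffact ((\<Sum>i<k. Var i) - of_nat m) n))"
    by (simp add: bdet_Leibniz sum_distrib_right mult.assoc)
  also have "\<dots> = (\<Sum>p\<in>?P. of_int (sign p) *
      (\<Sum>\<nu>\<in>?T. Const (fact n / (\<Prod>i<k. fact (\<nu> i)) * ?c p \<nu>) * (\<Prod>i<k. ffact (Var i) (\<nu> i))))"
  proof (intro sum.cong refl)
    fix p assume "p \<in> ?P"
    then have m: "m = (\<Sum>i<k. ms (p i))"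
      using assms(3) sum.permute[of p "{..<k}" ms] by simp
    show "of_int (sign p) *
        ((\<Prod>i<k. ffact (Var i) (ms (p i))) * ffact ((\<Sum>i<k. Var i) - of_nat m) n) =
      of_int (sign p) *
        (\<Sum>\<nu>\<in>?T. Const (fact n / (\<Prod>i<k. fact (\<nu> i)) * ?c p \<nu>) * (\<Prod>i<k. ffact (Var i) (\<nu> i)))"
      unfolding m prod_ffact_mult_ffact_sum ..
  qed
  also have "\<dots> = (\<Sum>\<nu>\<in>?T. \<Sum>p\<in>?P. of_int (sign p) *
      (Const (fact n / (\<Prod>i<k. fact (\<nu> i)) * ?c p \<nu>) * (\<Prod>i<k. ffact (Var i) (\<nu> i))))"
    unfolding sum_distrib_left by (rule sum.swap)
  also have "\<dots> = (\<Sum>\<nu>\<in>?T. Const (fact n / (\<Prod>i<k. fact (\<nu> i)) * bdet k ms (\<lambda>i. of_nat (\<nu> i))) *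
      (\<Prod>i<k. ffact (Var i) (\<nu> i)))"
    unfolding bdet_Leibniz sum_distrib_left Const_sum sum_distrib_right
    by (intro sum.cong refl) (simp only: Const_mult Const_sign mult_ac)
  finally show ?thesis .
qed

end
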